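(* Let $D_1,D_2\subset[0,1)\times\mathbb{R}^2$ be a pair of disjoint resonators repeated periodically with respect to $\Lambda=(1,0,0)^T\mathbb{Z}$, with material parameters $\delta_1v_1^2=:V_1\in\mathbb{C}\setminus\{0\}$ and $\delta_2v_2^2=:V_2\in\mathbb{C}\setminus\{0\}$. Let $Y^*=\mathbb{R}/2\pi\mathbb{Z}$ be the Brillouin zone and $\mathcal{C}^\alpha$ the associated quasiperiodic generalized capacitance matrix. Assume that the zeroth cell is defected, the material parameters of $D_1^0$ and $D_2^0$ being $V_1^{def}\in\mathbb{C}$ and $V_2^{def}\in\mathbb{C}$. Put $V:=\mathrm{diag}(V_1,V_2)$ and $V^{def}:=\mathrm{diag}(V_1^{def},V_2^{def})$. Then $\omega\in\mathbb{C}$ with $\omega^2\notin\bigcup_{\alpha\in Y^*}\sigma(\mathcal{C}^\alpha)$ is a defect mode eigenfrequency of this defected structure if and only if $$0=\det\left(V+(V^{def}-V)\frac{1}{|Y^*|}\int_{Y^*}\frac{1}{\det(\mathcal{C}^\alpha-\omega^2\mathrm{Id})}\left[\det(\mathcal{C}^\alpha)\mathrm{Id}-\omega^2\mathcal{C}^\alpha\right]d\alpha\right).$$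
   Context: Geometry and material. $D_1,D_2\subset[0,1)\times\mathbb{R}^2$ are disjoint bounded smooth simply connected domains (resonators), $D_i^m:=D_i+(m,0,0)^T$ for $m\in\mathbb{Z}$, $\mathcal{D}:=\bigcup_m(D_1^m\cup D_2^m)$. The functions $\rho,\kappa$ on $\mathbb{R}^3$ take constant complex values $\rho_i^m,\kappa_i^m$ on $D_i^m$ and $\rho_b,\kappa_b$ on $\mathbb{R}^3\setminus\mathcal{D}$. With $v_i^m=\sqrt{\kappa_i^m/\rho_i^m}$ and $\delta_i^m=\rho_i^m/\rho_b$, the "material parameter" of $D_i^m$ is $\delta_i^m(v_i^m)^2=\kappa_i^m/\rho_b$. High contrast: $\delta_i^m=O(\delta)$ as $\delta\to0$. In the periodic structure the parameters do not depend on $m$ and one writes $\delta_i,v_i$. Capacitance matrix. Let $G(x)=-\frac{1}{4\pi|x|}$, $G^\alpha(x)=\sum_{m\in\mathbb{Z}}G(x-(m,0,0)^T)e^{i\alpha m}$ for $\alpha\in Y^*\setminus\{0\}$, $|Y^*|=2\pi$, $D=D_1\cup D_2$, $\mathcal{S}_D^\alpha[\phi](x)=\int_{\partial D}G^\alpha(x-y)\phi(y)\,d\sigma(y)$ (invertible $L^2(\partial D)\to H^1(\partial D)$), $C^\alpha_{ij}=-\int_{\partial D_i}(\mathcal{S}_D^\alpha)^{-1}[\chi_{\partial D_j}]\,d\sigma$, and $\mathcal{C}^\alpha_{ij}=\frac{\delta_iv_i^2}{|D_i|}C^\alpha_{ij}$, $i,j\in\{1,2\}$, where $|D_i|$ is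 the volume. $\mathcal{C}^0$ is the limit of $\mathcal{C}^\alpha$ as $\alpha\to0$. $\sigma(\cdot)$ is the set of eigenvalues. Defects and defect modes. In finitely many resonators the material parameter $\delta_iv_i^2$ is replaced by $\delta_iv_i^2(1+x_i^m)$, $x_i^m\in\mathbb{C}$. A subwavelength solution is a family $(\omega_\delta,v_\delta)$, continuous in $\delta$, with $v_\delta\neq0$, $\omega_\delta\to0$ as $\delta\to0$, solving $\operatorname{div}(\rho^{-1}\nabla v)+\omega^2\kappa^{-1}v=0$ in $\mathbb{R}^3$. It is a localized (defect) mode, with defect mode eigenfrequency $\omega_\delta$, if $\int_{\mathbb{R}}|v_\delta(x_1,x_2,x_3)|^2dx_1<\infty$ for a.e. $(x_2,x_3)$ and $\omega_\delta^2\notin\bigcup_{\alpha}\sigma(\mathcal{C}^\alpha)$. Working characterization (quoted from earlier work, understood at leading order in $\delta$, taken as given and used as the operative meaning of the term). If only resonators in the cell $m=0$ are defected, with $X_0=\mathrm{diag}(x_1^0,x_2^0)$, then $\omega$ with $\omega^2\notin\bigcup_{\alpha\in Y^*}\sigma(\mathcal{C}^\alpha)$ is a defect mode eigenfrequency if and only if $\det(\mathrm{Id}-X_0T^0(\omega))=0$, where $T^0(\omega)=-\frac{1}{|Y^*|}\int_{Y^*}\mathcal{C}^\alpha(\mathcal{C}^\alpha-\omega^2\mathrm{Id})^{-1}d\alpha$ and $\mathcal{C}^\alpha$ is the capacitance matrix of the non-defected periodic structure. *)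

theory Defs
  imports "HOL-Analysis.Analysis"
begin

section \<open>Resonators\<close>

primrec times_cont_differentiable_on ::
    "nat \<Rightarrow> (real^3) set \<Rightarrow> (real^3 \<Rightarrow> real) \<Rightarrow> bool" where
  "times_cont_differentiable_on 0 U f \<longleftrightarrow> continuous_on U f"
| "times_cont_differentiable_on (Suc k) U f \<longleftrightarrow>
     (\<exists>g. (\<forall>x\<in>U. (f has_derivative (\<lambda>h. g x \<bullet> h)) (at x)) \<and>
          (\<forall>i. times_cont_differentiable_on k U (\<lambda>x. g x $ i)))"

definition smooth_function_on :: "(real^3) set \<Rightarrow> (real^3 \<Rightarrow> real) \<Rightarrow> bool" where
  "smooth_function_on U f \<longleftrightarrow> (\<forall>k. times_cont_differentiable_on k U f)"

text \<open>A domain with smooth boundary is, near each boundary point, the sublevel set of a smooth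
  function without critical points.\<close>

definition smooth_domain :: "(real^3) set \<Rightarrow> bool" where
  "smooth_domain \<Omega> \<longleftrightarrow> open \<Omega> \<and> connected \<Omega> \<and> \<Omega> \<noteq> {} \<and>
     (\<forall>p\<in>frontier \<Omega>. \<exists>U f. open U \<and> p \<in> U \<and> smooth_function_on U f \<and>
        (\<forall>x\<in>U. \<not> (f has_derivative (\<lambda>h. 0)) (at x)) \<and>
        \<Omega> \<inter> U = {x\<in>U. f x < 0})"

definition resonator :: "(real^3) set \<Rightarrow> bool" where
  "resonator \<Omega> \<longleftrightarrow> smooth_domain \<Omega> \<and> bounded \<Omega> \<and> simply_connected \<Omega> \<and>
     \<Omega> \<subseteq> {x. 0 \<le> x $ 1 \<and> x $ 1 < 1}"


section \<open>Surface measure\<close>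

text \<open>Surface measure is the two-dimensional Hausdorff measure, with the factor \<open>pi / 4\<close> that makes
  it the usual surface area on smooth surfaces. Boundedness of the covering sets is required
  explicitly because \<^const>\<open>diameter\<close> is unspecified on unbounded sets. The outer measure is a
  metric outer measure, hence countably additive on the Borel sets, so \<^const>\<open>measure_of\<close>
  does not collapse to the null measure.\<close>

definition hausdorff2_pre :: "real \<Rightarrow> (real^3) set \<Rightarrow> ennreal" where
  "hausdorff2_pre \<epsilon> A =
     (INF U \<in> {U :: nat \<Rightarrow> (real^3) set.
                 A \<subseteq> (\<Union>n. U n) \<and> (\<forall>n. bounded (U n) \<and> diameter (U n) < \<epsilon>)}.
        (\<Sum>n. ennreal (pi / 4 * (diameter (U n))\<^sup>2)))"

definition hausdorff2_outer :: "(real^3) set \<Rightarrow> ennreal" where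
  "hausdorff2_outer A = (SUP \<epsilon>\<in>{0<..}. hausdorff2_pre \<epsilon> A)"

definition surface_measure :: "(real^3) measure" where
  "surface_measure = measure_of UNIV (sets borel) hausdorff2_outer"


section \<open>Quasiperiodic single layer potential\<close>

definition green :: "real^3 \<Rightarrow> complex" where
  "green x = complex_of_real (- 1 / (4 * pi * norm x))"

text \<open>The lattice sum converges only conditionally, so it is taken as the limit of symmetric
  partial sums; an unconditional sum over the integers would not exist.\<close>

definition quasi_green :: "real \<Rightarrow> real^3 \<Rightarrow> complex" where
  "quasi_green \<alpha> x =
     lim (\<lambda>N. \<Sum>m\<in>{- int N..int N}. green (x - of_int m *\<^sub>R axis 1 1) * exp (\<i> * of_real (\<alpha> * of_int m)))"

definition single_layer ::
    "(real^3) set \<Rightarrow> real \<Rightarrow> (real^3 \<Rightarrow> complex) \<Rightarrow> real^3 \<Rightarrow> complex" where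
  "single_layer \<Omega> \<alpha> \<phi> x = (LINT y:frontier \<Omega>|surface_measure. quasi_green \<alpha> (x - y) * \<phi> y)"

definition boundary_L2 :: "(real^3) set \<Rightarrow> (real^3 \<Rightarrow> complex) set" where
  "boundary_L2 \<Omega> = {\<phi>. \<phi> \<in> borel_measurable borel \<and>
     set_integrable surface_measure (frontier \<Omega>) (\<lambda>y. (cmod (\<phi> y))\<^sup>2)}"

text \<open>The density is determined only up to surface-null sets, whence the choice operator; surface
  integrals of it do not depend on the choice.\<close>

definition single_layer_inverse ::
    "(real^3) set \<Rightarrow> real \<Rightarrow> (real^3 \<Rightarrow> complex) \<Rightarrow> real^3 \<Rightarrow> complex" where
  "single_layer_inverse \<Omega> \<alpha> g =
     (SOME \<phi>. \<phi> \<in> boundary_L2 \<Omega> \<and>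
        (AE x in surface_measure. x \<in> frontier \<Omega> \<longrightarrow> single_layer \<Omega> \<alpha> \<phi> x = g x))"


section \<open>Generalized capacitance matrix\<close>

definition capacitance :: "(2 \<Rightarrow> (real^3) set) \<Rightarrow> real \<Rightarrow> complex^2^2" where
  "capacitance D \<alpha> =
     (\<chi> i j. - (LINT y:frontier (D i)|surface_measure.
                 single_layer_inverse (D 1 \<union> D 2) \<alpha> (indicator (frontier (D j))) y))"

definition gen_capacitance_nonzero ::
    "(2 \<Rightarrow> (real^3) set) \<Rightarrow> complex^2 \<Rightarrow> real \<Rightarrow> complex^2^2" where
  "gen_capacitance_nonzero D V \<alpha> =
     (\<chi> i j. V $ i / of_real (measure lborel (D i)) * capacitance D \<alpha> $ i $ j)"

text \<open>Fundamental domain of the real line modulo \<open>2 * pi\<close>, in which 0 is the only representative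
  of the zero class and is an interior point.\<close>

definition brillouin_zone :: "real set" where
  "brillouin_zone = {- pi<..pi}"

definition gen_capacitance :: "(2 \<Rightarrow> (real^3) set) \<Rightarrow> complex^2 \<Rightarrow> real \<Rightarrow> complex^2^2" where
  "gen_capacitance D V \<alpha> =
     (if \<alpha> = 0 then Lim (at 0) (gen_capacitance_nonzero D V) else gen_capacitance_nonzero D V \<alpha>)"


section \<open>Defect modes\<close>

definition diag_matrix :: "complex^2 \<Rightarrow> complex^2^2" where
  "diag_matrix v = (\<chi> i j. if i = j then v $ i else 0)"

definition matrix_scale :: "complex \<Rightarrow> complex^2^2 \<Rightarrow> complex^2^2" where
  "matrix_scale c A = (\<chi> i j. c * A $ i $ j)"

definition eigenvalues :: "complex^2^2 \<Rightarrow> complex set" where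
  "eigenvalues A = {\<mu>. \<exists>v. v \<noteq> 0 \<and> A *v v = \<mu> *s v}"

definition band_spectrum :: "(2 \<Rightarrow> (real^3) set) \<Rightarrow> complex^2 \<Rightarrow> complex set" where
  "band_spectrum D V = (\<Union>\<alpha>\<in>brillouin_zone. eigenvalues (gen_capacitance D V \<alpha>))"

definition defect_T0 :: "(2 \<Rightarrow> (real^3) set) \<Rightarrow> complex^2 \<Rightarrow> complex \<Rightarrow> complex^2^2" where
  "defect_T0 D V \<omega> =
     - ((1 / measure lborel brillouin_zone) *\<^sub>R
          (LINT \<alpha>:brillouin_zone|lborel.
             gen_capacitance D V \<alpha> ** matrix_inv (gen_capacitance D V \<alpha> - mat (\<omega>\<^sup>2))))"

text \<open>Leading-order (in the contrast) notion of defect mode eigenfrequency, for a structure with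
  material parameters \<open>V\<close> whose zeroth cell has the parameters \<open>Vdef\<close>. The vector \<open>x\<close> contains
  the relative perturbations of the two resonators of that cell; it is unique when the entries of
  \<open>V\<close> do not vanish.\<close>

definition defect_mode_eigenfrequency ::
    "(2 \<Rightarrow> (real^3) set) \<Rightarrow> complex^2 \<Rightarrow> complex^2 \<Rightarrow> complex \<Rightarrow> bool" where
  "defect_mode_eigenfrequency D V Vdef \<omega> \<longleftrightarrow>
     \<omega>\<^sup>2 \<notin> band_spectrum D V \<and>
     (\<exists>x :: complex^2. (\<forall>i. Vdef $ i = V $ i * (1 + x $ i)) \<and>
        det (mat 1 - diag_matrix x ** defect_T0 D V \<omega>) = 0)"

end

theory Submission
  imports Defs
begin

text \<open>
  The operative characterization \<open>det (mat 1 - diag_matrix x ** T\<^sub>0) = 0\<close> and the one to be proved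
  involve the same determinant up to the nonzero factor \<open>det (diag_matrix V)\<close>. Two facts of linear
  algebra give this.

  For a \<open>2 \<times> 2\<close> matrix, the adjugate is linear in the matrix, so
  \<open>(A - mat \<mu>)\<^sup>-\<^sup>1 = (adj A - mat \<mu>) / det (A - mat \<mu>)\<close>. With \<open>A ** adj A = mat (det A)\<close> this turns
  \<open>A ** (A - mat \<mu>)\<^sup>-\<^sup>1\<close> into the rational expression under the integral
  (\<open>mult_resolvent_eq_adjugate\<close>). It applies at every \<open>\<alpha>\<close> of the Brillouin zone, because off the
  band spectrum \<open>det (C\<^sup>\<alpha> - mat (\<omega>\<^sup>2))\<close> never vanishes. The two integrands then agree
  pointwise on the zone, so \<open>T\<^sub>0 = - P\<close>, where \<open>P\<close> is the mean over the zone of the rational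
  expression (\<open>defect_T0_eq_adjugate_integral\<close>).

  The relative perturbations \<open>x\<close> satisfy
  \<open>diag_matrix V ** diag_matrix x = diag_matrix Vdef - diag_matrix V\<close>, so
  \<open>diag_matrix V ** (mat 1 - diag_matrix x ** T\<^sub>0)\<close> equals
  \<open>diag_matrix V + (diag_matrix Vdef - diag_matrix V) ** P\<close>. Taking determinants removes the
  relative perturbations in favour of the material parameters
  (\<open>det_relative_perturbation_eq_0_iff\<close>).
\<close>

lemma not_eigenvalue_imp_det_nonzero:
  assumes "\<mu> \<notin> eigenvalues A"
  shows "det (A - mat \<mu>) \<noteq> 0"
proof -
  have "(A - mat \<mu>) *v v = A *v v - \<mu> *s v" for v :: "complex^2"
    by (simp add: vec_eq_iff matrix_vector_mult_diff_rdistrib)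
      (simp add: matrix_vector_mult_def mat_def sum_2 forall_2)
  with assms have "\<forall>v. (A - mat \<mu>) *v v = 0 \<longrightarrow> v = 0"
    by (auto simp: eigenvalues_def)
  then show ?thesis
    unfolding invertible_det_nz[symmetric] invertible_left_inverse matrix_left_invertible_ker .
qed

lemma mult_matrix_inv_eqI:
  fixes A B M :: "'a::field^'n^'n"
  assumes "det M \<noteq> 0" and "B ** M = A"
  shows "A ** matrix_inv M = B"
proof -
  have "\<exists>M'. M ** M' = mat 1 \<and> M' ** M = mat 1"
    using assms(1) by (simp add: invertible_def flip: invertible_det_nz)
  then have "M ** matrix_inv M = mat 1"
    unfolding matrix_inv_def by (rule someI2_ex) simp
  then show ?thesis
    by (simp flip: assms(2) matrix_mul_assoc)
qed

text \<open>Clearing the inverse leaves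
  \<open>(mat (det A) - \<mu> A) ** (A - mat \<mu>) = det (A - mat \<mu>) A\<close>, which is the Cayley-Hamilton
  identity for \<open>A\<close> multiplied by \<open>\<mu>\<close>.\<close>

lemma mult_resolvent_eq_adjugate:
  assumes "det (A - mat \<mu>) \<noteq> 0"
  shows "A ** matrix_inv (A - mat \<mu>) =
    matrix_scale (1 / det (A - mat \<mu>)) (mat (det A) - matrix_scale \<mu> A)"
proof (rule mult_matrix_inv_eqI[OF assms])
  define d where "d = det (A - mat \<mu>)"
  have d: "d = (A$1$1 - \<mu>) * (A$2$2 - \<mu>) - A$1$2 * A$2$1" and "d \<noteq> 0"
    using assms by (simp_all add: d_def det_2 mat_def)
  have "(mat (det A) - matrix_scale \<mu> A) ** (A - mat \<mu>) = matrix_scale d A"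
    by (simp add: d vec_eq_iff matrix_matrix_mult_def matrix_scale_def mat_def sum_2 forall_2
        det_2 algebra_simps)
  moreover have "matrix_scale (1 / d) B ** M = matrix_scale (1 / d) (B ** M)" for B M
    by (simp add: vec_eq_iff matrix_matrix_mult_def matrix_scale_def sum_distrib_left mult.assoc)
  moreover have "matrix_scale (1 / d) (matrix_scale d A) = A"
    using \<open>d \<noteq> 0\<close> by (simp add: vec_eq_iff matrix_scale_def)
  ultimately show "matrix_scale (1 / det (A - mat \<mu>)) (mat (det A) - matrix_scale \<mu> A) ** (A - mat \<mu>) = A"
    by (simp add: d_def)
qed

lemma defect_T0_eq_adjugate_integral:
  assumes "\<omega>\<^sup>2 \<notin> band_spectrum D V"
  shows "defect_T0 D V \<omega> = - ((1 / measure lborel brillouin_zone) *\<^sub>R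
      (LINT \<alpha>:brillouin_zone|lborel.
        matrix_scale (1 / det (gen_capacitance D V \<alpha> - mat (\<omega>\<^sup>2)))
          (mat (det (gen_capacitance D V \<alpha>)) - matrix_scale (\<omega>\<^sup>2) (gen_capacitance D V \<alpha>))))"
proof -
  have "det (gen_capacitance D V \<alpha> - mat (\<omega>\<^sup>2)) \<noteq> 0" if "\<alpha> \<in> brillouin_zone" for \<alpha>
    using assms that by (intro not_eigenvalue_imp_det_nonzero) (auto simp: band_spectrum_def)
  then show ?thesis
    unfolding defect_T0_def
    by (intro arg_cong[where f = uminus] arg_cong[where f = "scaleR _"] set_lebesgue_integral_cong)
      (auto simp: brillouin_zone_def mult_resolvent_eq_adjugate)
qed

text \<open>Multiplication by \<open>diag_matrix V\<close> from the left turns relative perturbations into absolute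
  ones, without affecting whether the determinant vanishes.\<close>

lemma det_relative_perturbation_eq_0_iff:
  assumes "\<forall>i. V $ i \<noteq> 0" and x: "\<forall>i. Vdef $ i = V $ i * (1 + x $ i)"
  shows "det (mat 1 - diag_matrix x ** (- P)) = 0 \<longleftrightarrow>
    det (diag_matrix V + (diag_matrix Vdef - diag_matrix V) ** P) = 0"
proof -
  have "diag_matrix V + (diag_matrix Vdef - diag_matrix V) ** P
      = diag_matrix V ** (mat 1 - diag_matrix x ** (- P))"
    using x by (simp add: vec_eq_iff matrix_matrix_mult_def diag_matrix_def mat_def sum_2 forall_2
        algebra_simps)
  moreover have "det (diag_matrix V) \<noteq> 0"
    using assms(1) by (simp add: det_2 diag_matrix_def)
  ultimately show ?thesis
    by (simp add: det_mul)
qed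

theorem lemma4:
  fixes D :: "2 \<Rightarrow> (real^3) set" and V Vdef :: "complex^2" and \<omega> :: complex
  assumes "\<forall>i. resonator (D i)"
    and "D 1 \<inter> D 2 = {}"
    and "\<forall>i. V $ i \<noteq> 0"
    and "\<omega>\<^sup>2 \<notin> (\<Union>\<alpha>\<in>brillouin_zone. eigenvalues (gen_capacitance D V \<alpha>))"
  shows "defect_mode_eigenfrequency D V Vdef \<omega> \<longleftrightarrow>
    0 = det (diag_matrix V + (diag_matrix Vdef - diag_matrix V) **
      ((1 / measure lborel brillouin_zone) *\<^sub>R
        (LINT \<alpha>:brillouin_zone|lborel.
          matrix_scale (1 / det (gen_capacitance D V \<alpha> - mat (\<omega>\<^sup>2)))
            (mat (det (gen_capacitance D V \<alpha>)) - matrix_scale (\<omega>\<^sup>2) (gen_capacitance D V \<alpha>)))))"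
proof -
  let ?P = "(1 / measure lborel brillouin_zone) *\<^sub>R
      (LINT \<alpha>:brillouin_zone|lborel.
        matrix_scale (1 / det (gen_capacitance D V \<alpha> - mat (\<omega>\<^sup>2)))
          (mat (det (gen_capacitance D V \<alpha>)) - matrix_scale (\<omega>\<^sup>2) (gen_capacitance D V \<alpha>)))"
  have off_bands: "\<omega>\<^sup>2 \<notin> band_spectrum D V"
    using assms(4) by (simp add: band_spectrum_def)
  have T0: "defect_T0 D V \<omega> = - ?P"
    by (rule defect_T0_eq_adjugate_integral[OF off_bands])
  obtain x :: "complex^2" where x: "\<forall>i. Vdef $ i = V $ i * (1 + x $ i)"
  proof
    show "\<forall>i. Vdef $ i = V $ i * (1 + (\<chi> i. Vdef $ i / V $ i - 1) $ i)"
      using assms(3) by simp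
  qed
  have iff: "det (mat 1 - diag_matrix y ** defect_T0 D V \<omega>) = 0 \<longleftrightarrow>
      0 = det (diag_matrix V + (diag_matrix Vdef - diag_matrix V) ** ?P)"
    if "\<forall>i. Vdef $ i = V $ i * (1 + y $ i)" for y
    unfolding T0 det_relative_perturbation_eq_0_iff[OF assms(3) that] by (rule eq_commute)
  show ?thesis
    unfolding defect_mode_eigenfrequency_def using off_bands x iff by blast
qed

end
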